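(* Let $t\in\mathbb{C}_\infty$ with $|t|<q$. Then for every $z\in\mathbb{C}_\infty$ the series $$\sum_{j=0}^\infty b_j(\chi_t)\frac{e_j(z)}{D_j}$$ converges in $\mathbb{C}_\infty$, and for every $a\in A$ its sum at $z=a$ equals $a(t)$ (the value of the polynomial $a$ at $\theta=t$).
   Context: $q$ is a power of a prime, $A=\mathbb{F}_q[\theta]$, $K=\mathbb{F}_q(\theta)$, $K_\infty=\mathbb{F}_q((1/\theta))$ with absolute value normalized by $|\theta|=q$, and $\mathbb{C}_\infty$ the completion of an algebraic closure of $K_\infty$ with the extended absolute value. $A_+(d)$ is the set of monic polynomials of degree $d$, $A(d)$ the set of polynomials of degree $<d$ ($A(0)=\{0\}$); $D_d$ is the product of all monic polynomials of degree $d$, $L_d$ the lcm of all polynomials of degree $d$, $D_0=L_0=1$; $e_j(z):=\prod_{a\in A(j)}(z-a)$. For an indeterminate $t$, $\chi_t:A\to A[t]$ is the $\mathbb{F}_q$-algebra morphism with $\theta\mapsto t$, $M_j(\chi_t)(z):=\sum_{b\in A_+(j)}\chi_t(b)\prod_{a\in A_+(j)\setminus\{b\}}(z-a)\in A[t][z]$, and $b_j(\chi_t):=(-1)^j\frac{L_j}{D_j}M_j(\chi_t)(0)\in K[t]$; in the claim $b_j(\chi_t)$ is evaluated at the given $t\in\mathbb{C}_\infty$. *)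

theory Defs
  imports "HOL-Computational_Algebra.Computational_Algebra" "HOL-Library.Cardinality"
begin

text \<open>F_q is modelled by a finite field type 'a (q = CARD('a)); A = F_q[theta] is 'a poly.\<close>

definition Aplus :: "nat \<Rightarrow> ('a::field) poly set" where
  "Aplus d = {p. lead_coeff p = 1 \<and> degree p = d}"

text \<open>A(d): polynomials of degree < d, with A(0) = {0} (degree 0 = 0 in Isabelle).\<close>
definition Alt :: "nat \<Rightarrow> ('a::field) poly set" where
  "Alt d = {p. p = 0 \<or> degree p < d}"

definition Dprod :: "nat \<Rightarrow> ('a::field) poly" where
  "Dprod d = (\<Prod>b\<in>Aplus d. b)"

definition Llcm :: "nat \<Rightarrow> ('a::field_gcd) poly" where
  "Llcm d = (if d = 0 then 1 else Lcm {p. degree p = d})"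

text \<open>chi_t : A \<rightarrow> A[t], theta \<mapsto> t (coefficients in F_q become constants of A).\<close>
definition chi_t :: "('a::field) poly \<Rightarrow> 'a poly poly" where
  "chi_t a = map_poly (\<lambda>c. [:c:]) a"

text \<open>M_j(chi_t)(z) in A[t][z]; elements of A are constants of A[t].\<close>
definition Mchi :: "nat \<Rightarrow> ('a::field) poly poly poly" where
  "Mchi j = (\<Sum>b\<in>Aplus j. [:chi_t b:] * (\<Prod>a\<in>Aplus j - {b}. [:- [:a:], 1:]))"

definition Cinf_model :: "(('a::{finite,field}) poly \<Rightarrow> 'c::field) \<Rightarrow> ('c \<Rightarrow> real) \<Rightarrow> bool" where
  "Cinf_model \<iota> av \<longleftrightarrow>
     \<iota> 1 = 1 \<and> (\<forall>x y. \<iota> (x + y) = \<iota> x + \<iota> y) \<and> (\<forall>x y. \<iota> (x * y) = \<iota> x * \<iota> y) \<and>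
     (\<forall>x. av x \<ge> 0) \<and> (\<forall>x. av x = 0 \<longleftrightarrow> x = 0) \<and>
     (\<forall>x y. av (x * y) = av x * av y) \<and> (\<forall>x y. av (x + y) \<le> max (av x) (av y)) \<and>
     (\<forall>p. p \<noteq> 0 \<longrightarrow> av (\<iota> p) = real CARD('a) ^ degree p) \<and>
     (\<forall>X. (\<forall>e>0. \<exists>N. \<forall>m\<ge>N. \<forall>n\<ge>N. av (X m - X n) < e) \<longrightarrow>
          (\<exists>L. (\<lambda>n. av (L - X n)) \<longlonglongrightarrow> 0)) \<and>
     (\<forall>p::'c poly. degree p > 0 \<longrightarrow> (\<exists>x. poly p x = 0)) \<and>
     (\<forall>x e. e > 0 \<longrightarrow> (\<exists>y. av (x - y) < e \<and>
          (\<exists>p::'a poly poly. p \<noteq> 0 \<and> poly (map_poly \<iota> p) y = 0)))"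

text \<open>b_j(chi_t) in K[t], evaluated at t in C_infinity (via iota, extended to K).\<close>
definition b_at :: "('a::field_gcd poly \<Rightarrow> 'c::field) \<Rightarrow> 'c \<Rightarrow> nat \<Rightarrow> 'c" where
  "b_at \<iota> t j = (-1) ^ j * (\<iota> (Llcm j) / \<iota> (Dprod j)) * poly (map_poly \<iota> (poly (Mchi j) 0)) t"

definition e_at :: "('a::field poly \<Rightarrow> 'c::field) \<Rightarrow> nat \<Rightarrow> 'c \<Rightarrow> 'c" where
  "e_at \<iota> j z = (\<Prod>a\<in>Alt j. z - \<iota> a)"

definition poly_at :: "('a::field poly \<Rightarrow> 'c::field) \<Rightarrow> 'a poly \<Rightarrow> 'c \<Rightarrow> 'c" where
  "poly_at \<iota> a t = poly (map_poly (\<lambda>c. \<iota> [:c:]) a) t"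

definition series_sums :: "('c \<Rightarrow> real) \<Rightarrow> (nat \<Rightarrow> 'c::field) \<Rightarrow> 'c \<Rightarrow> bool" where
  "series_sums av f S \<longleftrightarrow> (\<lambda>n. av (S - (\<Sum>j<n. f j))) \<longlonglongrightarrow> 0"

end

theory Submission
  imports Defs
begin

text \<open>
  Let $G_d(z) = \sum_{j<d} b_j(\chi_t) e_j(z) / D_j$. Counting multiples of prime powers shows
  $L_d \prod_{0 \ne c \in A(d)} c = (-1)^d D_d$, so $(-1)^d (L_d / D_d) M_d(\chi_t)(z)$ is the Lagrange
  polynomial of degree $< q^d$ with value $b(t)$ at every $b \in A_+(d)$. If $G_d(a) = a(t)$ on $A(d)$,
  then $t^d + G_d(z - \theta^d)$ is the same polynomial, and evaluating at $z = 0$ gives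
  $b_d = t^d - G_d(\theta^d)$. As $e_d$ is $F_q$-linear and $e_d(\theta^d) = D_d$, it follows that
  $G_{d+1}(a) = a(t)$ on $A(d+1)$. The same product formula turns the size of the $j$-th term into
  $|\sum_{b \in A_+(j)} b(t)/b|$ times $|z| \prod_{0 \ne c \in A(j)} |1 - z/c|$; the first factor is at most
  $(\max(1,|t|)/q)^j$ and the second is bounded in $j$.
\<close>

section \<open>The sets A(d) and A_+(d): coefficients, reflection, cardinality\<close>

lemma Alt_iff_coeff: "p \<in> Alt d \<longleftrightarrow> (\<forall>i\<ge>d. coeff p i = 0)"
proof
  show "p \<in> Alt d \<Longrightarrow> \<forall>i\<ge>d. coeff p i = 0"
    by (auto simp: Alt_def intro: coeff_eq_0)
  assume *: "\<forall>i\<ge>d. coeff p i = 0"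
  have "degree p < d" if "p \<noteq> 0"
    using * that leading_coeff_0_iff not_le_imp_less by blast
  thus "p \<in> Alt d" by (auto simp: Alt_def)
qed

lemma Aplus_iff_coeff: "p \<in> Aplus d \<longleftrightarrow> coeff p d = 1 \<and> (\<forall>i>d. coeff p i = 0)"
proof
  show "p \<in> Aplus d \<Longrightarrow> coeff p d = 1 \<and> (\<forall>i>d. coeff p i = 0)"
    by (auto simp: Aplus_def intro: coeff_eq_0)
  assume *: "coeff p d = 1 \<and> (\<forall>i>d. coeff p i = 0)"
  have "degree p = d"
    using * by (intro antisym degree_le le_degree) auto
  thus "p \<in> Aplus d" using * by (auto simp: Aplus_def)
qed

text \<open>Two monic polynomials of the same degree d differ by an element of A(d). The reflection
  \<open>b - c\<close>, rather than a translation, makes the elements of A_+(d) the factors of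
  e_d(b).\<close>

lemma Aplus_eq_image_Alt:
  fixes b :: "'a::field poly"
  assumes "b \<in> Aplus d"
  shows "Aplus d = (\<lambda>c. b - c) ` Alt d"
proof (intro equalityI subsetI)
  fix x :: "'a poly" assume "x \<in> Aplus d"
  with assms have "b - x \<in> Alt d"
    unfolding Aplus_iff_coeff Alt_iff_coeff by (metis coeff_diff diff_self le_neq_implies_less)
  thus "x \<in> (\<lambda>c. b - c) ` Alt d" by (intro image_eqI[of _ _ "b - x"]) auto
qed (use assms in \<open>auto simp: Aplus_iff_coeff Alt_iff_coeff\<close>)

lemma Alt_Suc: "Alt (Suc d) = (\<lambda>(c, p). pCons c p) ` (UNIV \<times> Alt d)"
proof (intro equalityI subsetI)
  fix p :: "'a poly" assume p: "p \<in> Alt (Suc d)"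
  obtain c q where q: "p = pCons c q" by (cases p)
  have "q \<in> Alt d"
    using p unfolding q Alt_iff_coeff by (auto dest: spec[of _ "Suc _"])
  thus "p \<in> (\<lambda>(c, p). pCons c p) ` (UNIV \<times> Alt d)" using q by auto
qed (auto simp: Alt_iff_coeff coeff_pCons split: nat.splits)

lemma inj_on_pCons: "inj_on (\<lambda>(c, p). pCons c p) A"
  by (auto simp: inj_on_def)

lemma Alt_0: "Alt 0 = {0}"
  by (auto simp: Alt_def)

lemma finite_Alt: "finite (Alt d :: 'a::{finite,field} poly set)"
  by (induction d) (auto simp: Alt_0 Alt_Suc)

lemma card_Alt: "card (Alt d :: 'a::{finite,field} poly set) = CARD('a) ^ d"
  by (induction d) (simp_all add: Alt_0 Alt_Suc card_image[OF inj_on_pCons] card_cartesian_product)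

lemma monom_in_Aplus: "monom 1 d \<in> Aplus d"
  by (simp add: Aplus_iff_coeff)

lemma finite_Aplus: "finite (Aplus d :: 'a::{finite,field} poly set)"
  using Aplus_eq_image_Alt[OF monom_in_Aplus] finite_Alt by (metis finite_imageI)

lemma card_Aplus: "card (Aplus d :: 'a::{finite,field} poly set) = CARD('a) ^ d"
  by (subst Aplus_eq_image_Alt[OF monom_in_Aplus]) (simp add: card_Alt card_image inj_on_def)

lemma Aplus_nonzero: "b \<in> Aplus d \<Longrightarrow> b \<noteq> 0"
  by (auto simp: Aplus_def)

text \<open>This is D_d = e_d(b) for every monic b of degree d, the normalization of e_d used in the
  interpolation.\<close>

lemma Dprod_eq_prod_Alt:
  assumes "b \<in> Aplus d"
  shows "Dprod d = (\<Prod>c\<in>Alt d. b - c)"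
  unfolding Dprod_def Aplus_eq_image_Alt[OF assms] by (subst prod.reindex) (auto simp: inj_on_def)

lemma Dprod_nonzero: "Dprod d \<noteq> (0 :: 'a::{finite,field} poly)"
  by (auto simp: Dprod_def finite_Aplus dest: Aplus_nonzero)

section \<open>Fermat and Wilson for finite fields\<close>

lemma power_CARD_minus_one:
  fixes x :: "'a::{finite,field}"
  assumes "x \<noteq> 0"
  shows "x ^ (CARD('a) - 1) = 1"
proof -
  let ?w = "\<Prod>y\<in>UNIV - {0::'a}. y"
  have "bij_betw ((*) x) (UNIV - {0}) (UNIV - {0})"
    by (rule bij_betwI[of _ _ _ "\<lambda>y. y / x"]) (use assms in auto)
  hence "?w = (\<Prod>y\<in>UNIV - {0}. x * y)"
    using prod.reindex_bij_betw[of "(*) x" "UNIV - {0}" "UNIV - {0}" "\<lambda>y. y"] by simp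
  also have "\<dots> = x ^ (CARD('a) - 1) * ?w"
    by (simp add: prod.distrib card_Diff_singleton)
  finally show ?thesis by simp
qed

lemma power_CARD: "(x :: 'a::{finite,field}) ^ CARD('a) = x"
proof (cases "x = 0")
  case False
  have "x ^ CARD('a) = x ^ (CARD('a) - 1) * x"
    by (metis Suc_pred' power_Suc2 zero_less_card_finite)
  thus ?thesis using power_CARD_minus_one[OF False] by simp
qed (simp add: power_0_left)

lemma power_CARD_power: "(x :: 'a::{finite,field}) ^ (CARD('a) ^ n) = x"
  by (induction n) (simp_all add: power_mult power_CARD)

lemma CARD_field_ge_2: "CARD('a::{finite,field}) \<ge> 2"
  using card_mono[of UNIV "{0, 1 :: 'a}"] by simp

text \<open>Wilson: the product of the X - x over nonzero x and X^(q-1) - 1 are monic of degree q -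
  1 with the same q - 1 roots, hence equal. At X = 0 this gives the product of the -x, and negation
  permutes the nonzero elements.\<close>

lemma prod_nonzero_finite_field: "(\<Prod>x\<in>UNIV - {0::'a::{finite,field}}. x) = -1"
proof -
  let ?S = "UNIV - {0::'a}" and ?n = "CARD('a) - 1"
  let ?p = "\<Prod>x\<in>?S. [:-x, 1:]" and ?q = "monom 1 ?n - 1 :: 'a poly"
  have n: "?n > 0" using CARD_field_ge_2[where 'a='a] by simp
  have card: "card ?S = ?n" by (simp add: card_Diff_singleton)
  have degp: "degree ?p = ?n"
    by (subst degree_prod_sum_eq) (simp_all add: card)
  have "?p = ?q"
  proof (rule poly_eqI_degree_lead_coeff[where n = ?n and A = ?S])
    have "coeff ?p ?n = lead_coeff ?p" by (simp only: degp)
    also have "\<dots> = 1" by (simp add: lead_coeff_prod del: lead_coeff_pCons) 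
    also have "\<dots> = coeff ?q ?n" using n by simp
    finally show "coeff ?p ?n = coeff ?q ?n" .
    show "degree ?q \<le> ?n" by (intro degree_diff_le degree_monom_le) auto
    show "poly ?p z = poly ?q z" if "z \<in> ?S" for z
      using that power_CARD_minus_one[of z] by (simp add: poly_prod poly_monom)
  qed (use card degp in auto)
  hence "poly ?p 0 = poly ?q 0" by simp
  hence "(\<Prod>x\<in>?S. - x) = -1" using n by (simp add: poly_prod poly_monom)
  moreover have "bij_betw uminus ?S ?S"
    by (rule bij_betwI[of _ _ _ uminus]) auto
  hence "(\<Prod>x\<in>?S. - x) = (\<Prod>x\<in>?S. x)"
    by (rule prod.reindex_bij_betw)
  ultimately show ?thesis by simp
qed

section \<open>The product formula linking L_d, D_d and the nonzero elements of A(d)\<close>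

lemma prod_lead_coeff_Alt:
  "(\<Prod>c\<in>Alt d - {0}. lead_coeff c) = ((-1) ^ d :: 'a::{finite,field})"
proof (induction d)
  case (Suc d)
  \<comment> \<open>Split by whether the part p above the constant term vanishes. For p nonzero the
    leading coefficient is that of p and occurs once per constant term, so the product is a q-th
    power, which Fermat leaves unchanged; the nonzero constants contribute -1 by Wilson.\<close>
  have "Alt (Suc d) - {0 :: 'a poly} = (\<lambda>(c, p). pCons c p) `
          (UNIV \<times> (Alt d - {0}) \<union> (UNIV - {0}) \<times> {0})"
    unfolding Alt_Suc by (auto simp: Alt_def)
  hence "(\<Prod>c\<in>Alt (Suc d) - {0 :: 'a poly}. lead_coeff c) =
      (\<Prod>(c, p)\<in>UNIV \<times> (Alt d - {0}) \<union> (UNIV - {0}) \<times> {0}. lead_coeff (pCons c p :: 'a poly))"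
    by (simp only: prod.reindex[OF inj_on_pCons]) (simp only: comp_def case_prod_unfold)
  also have "\<dots> = (\<Prod>(c, p)\<in>UNIV \<times> (Alt d - {0}). lead_coeff (pCons c p :: 'a poly)) *
                 (\<Prod>(c, p)\<in>(UNIV - {0}) \<times> {0}. lead_coeff (pCons c p :: 'a poly))"
    by (rule prod.union_disjoint) (auto simp: finite_Alt)
  also have "(\<Prod>(c, p)\<in>UNIV \<times> (Alt d - {0}). lead_coeff (pCons c p :: 'a poly)) =
             (\<Prod>c\<in>(UNIV :: 'a set). \<Prod>p\<in>Alt d - {0}. lead_coeff p)"
    by (subst prod.cartesian_product [symmetric]) (intro prod.cong, auto)
  also have "\<dots> = (-1) ^ d" by (simp add: Suc.IH power_CARD)
  also have "(\<Prod>(c, p)\<in>(UNIV - {0}) \<times> {0}. lead_coeff (pCons c p :: 'a poly)) = -1"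
    by (subst prod.cartesian_product [symmetric]) (simp add: prod_nonzero_finite_field)
  finally show ?case by simp
qed (simp add: Alt_0)

text \<open>If N has a monic multiple b0 of degree d, then c \<mapsto> b0 - c matches the multiples
  of N in A(d) with those in A_+(d); the extra 1 stands for c = 0. If degree N > d, neither set
  contains a multiple.\<close>

lemma card_dvd_Aplus:
  fixes N :: "'a::{finite,field} poly"
  assumes "N \<noteq> 0"
  shows "card {b \<in> Aplus d. N dvd b} =
         card {c \<in> Alt d - {0}. N dvd c} + (if degree N \<le> d then 1 else 0)"
proof (cases "degree N \<le> d")
  case True
  \<comment> \<open>N is padded by a power of \<theta> to degree d and made monic.\<close>
  define b0 where "b0 = smult (inverse (lead_coeff N)) (N * monom 1 (d - degree N))"
  have b0: "b0 \<in> Aplus d"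
  proof -
    have "degree b0 = d"
      using True assms by (simp add: b0_def degree_mult_eq degree_monom_eq monom_eq_0_iff)
    moreover have "lead_coeff b0 = 1"
      unfolding b0_def lead_coeff_smult lead_coeff_mult lead_coeff_monom using assms by simp
    ultimately
    show ?thesis by (simp add: Aplus_def)
  qed
  have dvd: "N dvd b0" by (simp add: b0_def dvd_smult)
  have "{b \<in> Aplus d. N dvd b} = (\<lambda>c. b0 - c) ` {c \<in> Alt d. N dvd c}"
    unfolding Aplus_eq_image_Alt[OF b0] using dvd by (auto simp: dvd_diff_right_iff dvd_diff_left_iff)
  hence "card {b \<in> Aplus d. N dvd b} = card {c \<in> Alt d. N dvd c}"
    by (simp add: card_image inj_on_def)
  also have "{c \<in> Alt d. N dvd c} = insert 0 {c \<in> Alt d - {0}. N dvd c}"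
    by (auto simp: Alt_def)
  also have "card \<dots> = card {c \<in> Alt d - {0}. N dvd c} + 1"
    by (subst card_insert_disjoint) (auto intro: finite_subset[OF _ finite_Alt[of d]])
  finally show ?thesis using True by simp
next
  case False
  have "{b \<in> Aplus d. N dvd b} = {}" "{c \<in> Alt d - {0}. N dvd c} = {}"
    using False by (auto simp: Aplus_def Alt_def dest: dvd_imp_degree_le)
  thus ?thesis using False by (simp only: if_False card.empty)
qed

text \<open>The multiplicity of P in s counts the k \<ge> 1 with \<open>P ^ k dvd s\<close>;
  exchanging the two sums counts the s for each k instead. Stopping at k = d loses nothing, since P
  has degree at least 1.\<close>

lemma multiplicity_prod_eq_sum_card:
  fixes P :: "'a::{finite,field_gcd} poly"
  assumes P: "prime P" and "finite S" "0 \<notin> S" and deg: "\<And>s. s \<in> S \<Longrightarrow> degree s \<le> d"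
  shows "multiplicity P (\<Prod>S) = (\<Sum>k=1..d. card {s \<in> S. P ^ k dvd s})"
proof -
  have P0: "P \<noteq> 0" "\<not> is_unit P" using P by auto
  have degP: "degree P > 0" using P0 by (simp add: is_unit_iff_degree)
  have mult: "multiplicity P s = (\<Sum>k=1..d. if P ^ k dvd s then 1 else 0)" if s: "s \<in> S" for s
  proof -
    have s0: "s \<noteq> 0" using s assms by auto
    have "multiplicity P s \<le> degree P * multiplicity P s" using degP by simp
    also have "\<dots> = degree (P ^ multiplicity P s)" by (simp add: degree_power_eq P0)
    also have "\<dots> \<le> degree s" using s0 by (intro dvd_imp_degree_le multiplicity_dvd)
    also have "\<dots> \<le> d" using s by (rule deg)
    finally have "{k \<in> {1..d}. P ^ k dvd s} = {1..multiplicity P s}"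
      using P0 s0 by (auto simp: power_dvd_iff_le_multiplicity)
    thus ?thesis by (simp add: sum.If_cases Int_def)
  qed
  have "multiplicity P (\<Prod>S) = (\<Sum>s\<in>S. multiplicity P s)"
    using P assms by (subst prime_elem_multiplicity_prod_distrib) (auto simp: image_iff)
  also have "\<dots> = (\<Sum>s\<in>S. \<Sum>k=1..d. if P ^ k dvd s then 1 else 0)"
    by (intro sum.cong refl mult)
  also have "\<dots> = (\<Sum>k=1..d. \<Sum>s\<in>S. if P ^ k dvd s then 1 else 0)"
    by (rule sum.swap)
  also have "\<dots> = (\<Sum>k=1..d. card {s \<in> S. P ^ k dvd s})"
    using assms by (simp add: sum.If_cases Int_def)
  finally show ?thesis .
qed

text \<open>The multiplicity of a prime in an lcm is the maximum of the multiplicities, so one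
  element already carries the whole power. A divisor with several prime factors could be assembled
  from different elements.\<close>

lemma prime_power_dvd_Lcm:
  fixes P :: "'a::factorial_semiring_gcd"
  assumes "prime P" "finite S" "S \<noteq> {}" "0 \<notin> S" "P ^ k dvd Lcm S"
  shows "\<exists>s\<in>S. P ^ k dvd s"
  using assms(2-)
proof (induction S rule: finite_ne_induct)
  case (insert x S)
  have ne: "Lcm S \<noteq> 0" "x \<noteq> 0" using insert by (auto simp: Lcm_0_iff)
  hence "lcm x (Lcm S) \<noteq> 0" by (simp add: lcm_eq_0_iff)
  with insert.prems ne assms(1) have "P ^ k dvd x \<or> P ^ k dvd Lcm S"
    by (auto simp: power_dvd_iff_le_multiplicity multiplicity_lcm not_prime_unit)
  thus ?case using insert by auto
qed auto

text \<open>The Lcm of a finite set vanishes only if the set contains 0, and for d > 0 the zero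
  polynomial, whose \<open>degree\<close> is 0, is not among those of degree d.\<close>

lemma Llcm_nonzero: "Llcm d \<noteq> (0 :: 'a::{finite,field_gcd} poly)"
proof (cases "d = 0")
  case False
  have "finite {p :: 'a poly. degree p = d}"
    by (rule finite_subset[OF _ finite_Alt[of "Suc d"]]) (auto simp: Alt_def)
  thus ?thesis using False by (auto simp: Llcm_def Lcm_0_iff)
qed (simp add: Llcm_def)

text \<open>\<open>Lcm\<close> returns a normalized element, and a nonzero normalized polynomial
  over a field is monic.\<close>

lemma lead_coeff_Llcm: "lead_coeff (Llcm d :: 'a::{finite,field_gcd} poly) = 1"
proof -
  let ?l = "lead_coeff (Llcm d :: 'a poly)"
  have "normalize (Llcm d :: 'a poly) = Llcm d" by (simp add: Llcm_def)
  hence "unit_factor (Llcm d :: 'a poly) = 1"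
    using Llcm_nonzero[of d, where 'a='a] unit_factor_normalize by metis
  hence "unit_factor ?l = 1" by (simp add: unit_factor_poly_def one_pCons)
  moreover have "normalize ?l = 1"
    using Llcm_nonzero[of d, where 'a='a] by (simp add: is_unit_normalize dvd_field_iff)
  ultimately show ?thesis using unit_factor_mult_normalize[of ?l] by simp
qed

lemma prime_power_dvd_Llcm_iff:
  fixes P :: "'a::{finite,field_gcd} poly"
  assumes "prime P" "d > 0"
  shows "P ^ k dvd Llcm d \<longleftrightarrow> degree (P ^ k) \<le> d"
proof
  let ?S = "{p :: 'a poly. degree p = d}"
  assume "P ^ k dvd Llcm d"
  hence *: "P ^ k dvd Lcm ?S" using assms by (simp add: Llcm_def)
  have "finite ?S"
    by (rule finite_subset[OF _ finite_Alt[of "Suc d"]]) (auto simp: Alt_def)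
  moreover have "?S \<noteq> {}" using degree_monom_eq[of "1::'a" d] by force
  moreover have "0 \<notin> ?S" using assms by simp
  ultimately obtain s where s: "s \<in> ?S" "P ^ k dvd s"
    using prime_power_dvd_Lcm[OF assms(1) _ _ _ *] by blast
  hence "s \<noteq> 0" using assms by auto
  thus "degree (P ^ k) \<le> d" using s dvd_imp_degree_le[of "P ^ k" s] by auto
next
  assume le: "degree (P ^ k) \<le> d"
  have "P ^ k \<noteq> 0" using assms by auto
  \<comment> \<open>A power of \<theta> fills \<open>P ^ k\<close> up to degree exactly d, giving a
    member of the set whose lcm is taken.\<close>
  hence "degree (P ^ k * monom 1 (d - degree (P ^ k))) = d"
    using le by (simp add: degree_mult_eq degree_monom_eq monom_eq_0_iff)
  hence "P ^ k * monom 1 (d - degree (P ^ k)) dvd Llcm d"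
    using assms by (auto simp: Llcm_def intro: dvd_Lcm)
  thus "P ^ k dvd Llcm d" by (rule dvd_mult_left)
qed

text \<open>Written as a sum over k so that it adds termwise to the counts in
  \<open>card_dvd_Aplus\<close>.\<close>

lemma multiplicity_Llcm:
  fixes P :: "'a::{finite,field_gcd} poly"
  assumes P: "prime P" and "d > 0"
  shows "multiplicity P (Llcm d) = (\<Sum>k=1..d. if degree (P ^ k) \<le> d then 1 else 0)"
proof -
  have P0: "P \<noteq> 0" "\<not> is_unit P" using P by auto
  have degP: "degree P > 0" using P0 by (simp add: is_unit_iff_degree)
  have iff: "k \<le> multiplicity P (Llcm d) \<longleftrightarrow> degree (P ^ k) \<le> d" for k
    using prime_power_dvd_Llcm_iff[OF assms, of k] P0 Llcm_nonzero[of d, where 'a='a]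
    by (simp add: power_dvd_iff_le_multiplicity)
  have "k \<le> d" if "degree (P ^ k) \<le> d" for k
  proof -
    have "k * 1 \<le> k * degree P" using degP by (intro mult_le_mono2) simp
    also have "\<dots> \<le> d" using that by (simp add: degree_power_eq P0)
    finally show ?thesis by simp
  qed
  hence "{k \<in> {1..d}. degree (P ^ k) \<le> d} = {1..multiplicity P (Llcm d)}"
    by (auto simp: iff)
  thus ?thesis by (simp add: sum.If_cases Int_def)
qed

text \<open>For each prime power the multiples in A_+(d) outnumber the nonzero ones in A(d) by
  exactly its contribution to L_d. Hence both sides have the same multiplicity at every prime and
  are associated.\<close>

lemma Llcm_times_prod_Alt:
  "Llcm d * (\<Prod>c\<in>Alt d - {0}. c) = ((-1) ^ d * Dprod d :: 'a::{finite,field_gcd} poly)"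
proof (cases "d = 0")
  case True
  have "Aplus 0 = {1 :: 'a poly}" by (auto simp: Aplus_def one_pCons elim: degree_eq_zeroE)
  thus ?thesis using True by (simp add: Llcm_def Dprod_def Alt_0)
next
  case False
  let ?Q = "\<Prod>c\<in>Alt d - {0}. c :: 'a poly"
  have Q0: "?Q \<noteq> 0" by (simp add: finite_Alt)
  have mult: "multiplicity P (Llcm d * ?Q) = multiplicity P (Dprod d)" if P: "prime P" for P
  proof -
    have "multiplicity P (Llcm d * ?Q) = multiplicity P (Llcm d) + multiplicity P ?Q"
      using P Q0 Llcm_nonzero by (intro prime_elem_multiplicity_mult_distrib) auto
    also have "multiplicity P ?Q = (\<Sum>k=1..d. card {c \<in> Alt d - {0}. P ^ k dvd c})"
      using P by (intro multiplicity_prod_eq_sum_card finite_Diff finite_Alt) (auto simp: Alt_def)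
    also have "multiplicity P (Llcm d) + \<dots> = (\<Sum>k=1..d. card {b \<in> Aplus d. P ^ k dvd b})"
      using P False by (subst multiplicity_Llcm)
        (auto simp: sum.distrib [symmetric] card_dvd_Aplus intro!: sum.cong)
    also have "\<dots> = multiplicity P (Dprod d)"
      unfolding Dprod_def using P
      by (intro multiplicity_prod_eq_sum_card [symmetric] finite_Aplus) (auto simp: Aplus_def)
    finally show ?thesis .
  qed
  have "prime_factorization (Llcm d * ?Q) = prime_factorization (Dprod d)"
    by (rule multiset_eqI) (simp add: count_prime_factorization mult)
  hence "normalize (Llcm d * ?Q) = normalize (Dprod d)"
    using Q0 Llcm_nonzero Dprod_nonzero by (subst (asm) prime_factorization_unique) auto
  then obtain u where u: "is_unit u" "Llcm d * ?Q = u * Dprod d"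
    using associatedE1 by blast
  then obtain c where c: "u = [:c:]"
    using is_unit_poly_iff by blast
  \<comment> \<open>The remaining unit is a constant. As L_d and D_d are monic, it equals the
    product of the leading coefficients over A(d) without 0.\<close>
  have "lead_coeff (Llcm d * ?Q) = (-1) ^ d"
    unfolding lead_coeff_mult lead_coeff_Llcm lead_coeff_prod prod_lead_coeff_Alt by simp
  moreover have "lead_coeff (Dprod d :: 'a poly) = 1"
    unfolding Dprod_def lead_coeff_prod by (rule prod.neutral) (auto simp: Aplus_def)
  ultimately have "c = (-1) ^ d"
    unfolding u(2) lead_coeff_mult c by simp
  hence "u = (-1) ^ d" using c by (simp add: one_pCons flip: poly_const_pow)
  thus ?thesis using u(2) by simp
qed

section \<open>Embeddings of A into a field, and the F_q-linearity of e_j\<close>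

locale poly_embedding =
  fixes \<iota> :: "'a::{finite,field_gcd} poly \<Rightarrow> 'c::field"
  assumes hom_1 [simp]: "\<iota> 1 = 1"
    and hom_add: "\<iota> (x + y) = \<iota> x + \<iota> y"
    and hom_mult: "\<iota> (x * y) = \<iota> x * \<iota> y"
    and hom_eq_0: "\<iota> x = 0 \<Longrightarrow> x = 0"
begin

lemma hom_0 [simp]: "\<iota> 0 = 0"
  using hom_add[of 0 0] by (metis add.right_neutral add_left_cancel)

lemma hom_uminus: "\<iota> (- x) = - \<iota> x"
  using hom_add[of x "-x"] by (simp add: eq_neg_iff_add_eq_0 add.commute)

lemma hom_diff: "\<iota> (x - y) = \<iota> x - \<iota> y"
  using hom_add[of x "-y"] by (simp add: hom_uminus)

lemma hom_prod: "\<iota> (\<Prod>x\<in>S. f x) = (\<Prod>x\<in>S. \<iota> (f x))"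
  by (induction S rule: infinite_finite_induct) (auto simp: hom_mult)

lemma hom_power: "\<iota> (x ^ n) = \<iota> x ^ n"
  by (induction n) (auto simp: hom_mult)

lemma inj_hom: "inj \<iota>"
  by (rule injI) (metis eq_iff_diff_eq_0 hom_diff hom_eq_0)

lemma hom_Dprod_nonzero [simp]: "\<iota> (Dprod j) \<noteq> 0"
  using hom_eq_0 Dprod_nonzero by blast

text \<open>e_j as a polynomial over \<open>'c\<close>, so that identities follow by comparing
  degrees and values at enough points.\<close>

definition e_poly :: "nat \<Rightarrow> 'c poly" where
  "e_poly j = (\<Prod>a\<in>Alt j. [:- \<iota> a, 1:])"

lemma poly_e_poly [simp]: "poly (e_poly j) z = e_at \<iota> j z"
  by (simp add: e_poly_def e_at_def poly_prod)

lemma degree_e_poly: "degree (e_poly j) = CARD('a) ^ j"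
  unfolding e_poly_def by (subst degree_prod_sum_eq) (simp_all add: card_Alt)

lemma lead_coeff_e_poly: "lead_coeff (e_poly j) = 1"
  unfolding e_poly_def lead_coeff_prod by (rule prod.neutral) simp

lemma e_at_Alt: "a \<in> Alt j \<Longrightarrow> e_at \<iota> j (\<iota> a) = 0"
  by (auto simp: e_at_def finite_Alt)

lemma e_at_0 [simp]: "e_at \<iota> j 0 = 0"
  using e_at_Alt[of 0 j] by (simp add: Alt_def)

lemma e_at_Aplus: "b \<in> Aplus j \<Longrightarrow> e_at \<iota> j (\<iota> b) = \<iota> (Dprod j)"
  by (simp add: e_at_def Dprod_eq_prod_Alt hom_prod hom_diff)

lemma e_at_periodic:
  assumes "a \<in> Alt j"
  shows "e_at \<iota> j (\<iota> a + y) = e_at \<iota> j y"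
proof -
  have "bij_betw (\<lambda>c. c - a) (Alt j) (Alt j)"
    by (rule bij_betwI[of _ _ _ "\<lambda>c. c + a"]) (use assms in \<open>auto simp: Alt_iff_coeff\<close>)
  from prod.reindex_bij_betw[OF this, of "\<lambda>c. y - \<iota> c"]
  show ?thesis by (simp add: e_at_def hom_diff algebra_simps)
qed

text \<open>Both sides are monic of degree $q^j$ in $x$ and agree on the $q^j$ points of $A(j)$.\<close>
lemma e_at_add: "e_at \<iota> j (x + y) = e_at \<iota> j x + e_at \<iota> j y"
proof -
  let ?p = "pcompose (e_poly j) [:y, 1:]" and ?q = "e_poly j + [:e_at \<iota> j y:]"
  let ?n = "CARD('a) ^ j"
  have n: "?n > 0" by simp
  have deg: "degree ?p = ?n" by (simp add: degree_pcompose degree_e_poly)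
  have coeff_e: "coeff (e_poly j) ?n = 1" using lead_coeff_e_poly degree_e_poly by metis
  have "?p = ?q"
  proof (rule poly_eqI_degree_lead_coeff[where n = ?n and A = "\<iota> ` Alt j"])
    have "coeff ?p ?n = lead_coeff ?p" by (simp only: deg)
    also have "\<dots> = 1" by (simp add: lead_coeff_comp lead_coeff_e_poly)
    also have "\<dots> = coeff ?q ?n" using n by (auto simp: coeff_e coeff_pCons split: nat.splits)
    finally show "coeff ?p ?n = coeff ?q ?n" .
    show "degree ?q \<le> ?n" by (intro degree_add_le) (simp_all add: degree_e_poly)
    show "card (\<iota> ` Alt j) \<ge> ?n"
      using card_image[OF inj_on_subset[OF inj_hom subset_UNIV], of "Alt j"] by (simp add: card_Alt)
    show "poly ?p z = poly ?q z" if "z \<in> \<iota> ` Alt j" for z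
      using that e_at_periodic[of _ j y] by (auto simp: poly_pcompose e_at_Alt add.commute)
  qed (use deg in auto)
  hence "poly ?p x = poly ?q x" by simp
  thus ?thesis by (simp add: poly_pcompose add.commute)
qed

lemma e_at_uminus: "e_at \<iota> j (- x) = - e_at \<iota> j x"
  using e_at_add[of j x "-x"] by (simp add: eq_neg_iff_add_eq_0 add.commute)

text \<open>For c nonzero, scaling by c permutes A(j), so c comes out of each of the q^j factors,
  and c^(q^j) = c.\<close>

lemma e_at_scale: "e_at \<iota> j (\<iota> [:c:] * z) = \<iota> [:c:] * e_at \<iota> j z"
proof (cases "c = 0")
  case False
  have "bij_betw (smult c) (Alt j) (Alt j)"
    by (rule bij_betwI[of _ _ _ "smult (inverse c)"]) (use False in \<open>auto simp: Alt_iff_coeff\<close>)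
  from prod.reindex_bij_betw[OF this, of "\<lambda>a. \<iota> [:c:] * z - \<iota> a"]
  have "e_at \<iota> j (\<iota> [:c:] * z) = (\<Prod>a\<in>Alt j. \<iota> [:c:] * z - \<iota> ([:c:] * a))"
    by (simp add: e_at_def)
  also have "\<dots> = \<iota> [:c:] ^ (CARD('a) ^ j) * e_at \<iota> j z"
    by (simp only: hom_mult right_diff_distrib [symmetric] prod.distrib e_at_def prod_constant card_Alt)
  also have "\<iota> [:c:] ^ (CARD('a) ^ j) = \<iota> [:c ^ (CARD('a) ^ j):]"
    by (simp add: hom_power [symmetric] poly_const_pow)
  finally show ?thesis by (simp add: power_CARD_power)
qed simp

section \<open>Evaluation at t, and M_j(0) as a sum in the target field\<close>

lemma poly_map_add: "poly (map_poly \<iota> (p + q)) t = poly (map_poly \<iota> p) t + poly (map_poly \<iota> q) t"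
proof -
  have "map_poly \<iota> (p + q) = map_poly \<iota> p + map_poly \<iota> q"
    by (rule poly_eqI) (simp add: coeff_map_poly hom_add)
  thus ?thesis by simp
qed

lemma poly_map_mult: "poly (map_poly \<iota> (p * q)) t = poly (map_poly \<iota> p) t * poly (map_poly \<iota> q) t"
proof (induction p)
  case (pCons a p)
  have "map_poly \<iota> (smult a q) = smult (\<iota> a) (map_poly \<iota> q)"
    by (rule map_poly_smult) (simp_all add: hom_mult)
  thus ?case using pCons
    by (simp add: poly_map_add map_poly_pCons algebra_simps)
qed simp

lemma poly_map_sum: "poly (map_poly \<iota> (\<Sum>x\<in>S. f x)) t = (\<Sum>x\<in>S. poly (map_poly \<iota> (f x)) t)"
  by (induction S rule: infinite_finite_induct) (auto simp: poly_map_add)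

lemma poly_map_prod: "poly (map_poly \<iota> (\<Prod>x\<in>S. f x)) t = (\<Prod>x\<in>S. poly (map_poly \<iota> (f x)) t)"
  by (induction S rule: infinite_finite_induct) (auto simp: poly_map_mult)

lemma poly_at_add: "poly_at \<iota> (a + b) t = poly_at \<iota> a t + poly_at \<iota> b t"
proof -
  have "\<iota> [:x + y:] = \<iota> [:x:] + \<iota> [:y:]" for x y
    by (simp add: hom_add [symmetric])
  hence "map_poly (\<lambda>c. \<iota> [:c:]) (a + b) = map_poly (\<lambda>c. \<iota> [:c:]) a + map_poly (\<lambda>c. \<iota> [:c:]) b"
    by (intro poly_eqI) (simp add: coeff_map_poly)
  thus ?thesis by (simp add: poly_at_def)
qed

lemma poly_at_monom: "poly_at \<iota> (monom c d) t = \<iota> [:c:] * t ^ d"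
  by (simp add: poly_at_def map_poly_monom poly_monom)

lemma Mchi_at_0:
  "poly (map_poly \<iota> (poly (Mchi j) 0)) t =
     (\<Sum>b\<in>Aplus j. poly_at \<iota> b t * (\<Prod>a\<in>Aplus j - {b}. - \<iota> a))"
proof -
  have "poly (map_poly \<iota> (chi_t b)) t = poly_at \<iota> b t" for b
    by (simp add: chi_t_def poly_at_def map_poly_map_poly o_def)
  thus ?thesis
    by (simp add: Mchi_def poly_sum poly_prod poly_map_sum poly_map_mult poly_map_prod
        map_poly_pCons hom_uminus)
qed

section \<open>Interpolation by the partial sums, the G_d of the overview\<close>

definition partial_sum :: "'c \<Rightarrow> nat \<Rightarrow> 'c \<Rightarrow> 'c" where
  "partial_sum t d z = (\<Sum>j<d. b_at \<iota> t j * (e_at \<iota> j z / \<iota> (Dprod j)))"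

lemma partial_sum_add: "partial_sum t d (x + y) = partial_sum t d x + partial_sum t d y"
  by (simp add: partial_sum_def e_at_add sum.distrib algebra_simps add_divide_distrib)

lemma partial_sum_uminus: "partial_sum t d (- x) = - partial_sum t d x"
  by (simp add: partial_sum_def e_at_uminus sum_negf)

lemma partial_sum_scale: "partial_sum t d (\<iota> [:c:] * x) = \<iota> [:c:] * partial_sum t d x"
  unfolding partial_sum_def sum_distrib_left e_at_scale by (intro sum.cong) simp_all

lemma hom_prod_Alt_nonzero: "(\<Prod>c\<in>Alt d - {0}. \<iota> c) \<noteq> 0"
  using hom_eq_0 by (auto simp: finite_Alt)

lemma hom_Llcm: "\<iota> (Llcm d) * (\<Prod>c\<in>Alt d - {0}. \<iota> c) = (-1) ^ d * \<iota> (Dprod d)"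
  using arg_cong[OF Llcm_times_prod_Alt, of \<iota> d]
  by (simp add: hom_mult hom_prod hom_power hom_uminus)

lemma b_at_eq:
  assumes IH: "\<And>a. a \<in> Alt d \<Longrightarrow> partial_sum t d (\<iota> a) = poly_at \<iota> a t"
  shows "b_at \<iota> t d = t ^ d - partial_sum t d (\<iota> (monom 1 d))"
proof -
  \<comment> \<open>As a runs over A_+(d) without b, the differences b - a run over the nonzero
    elements of A(d), so all Lagrange denominators coincide. By \<open>hom_Llcm\<close>,
    \<open>k\<close> is the reciprocal of that product and \<open>F\<close> the Lagrange polynomial;
    \<open>H\<close> is t^d plus the partial sum shifted by \<theta>^d.\<close>
  define k where "k = (-1) ^ d * (\<iota> (Llcm d) / \<iota> (Dprod d))"
  define F where "F = smult k (\<Sum>b\<in>Aplus d. smult (poly_at \<iota> b t)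
                        (\<Prod>a\<in>Aplus d - {b}. [:- \<iota> a, 1:]))"
  define H where "H = [:t ^ d:] + (\<Sum>j<d. smult (b_at \<iota> t j / \<iota> (Dprod j))
                        (pcompose (e_poly j) [:- \<iota> (monom 1 d), 1:]))"
  have k: "k * (\<Prod>c\<in>Alt d - {0}. \<iota> c) = 1"
  proof -
    have "k * (\<Prod>c\<in>Alt d - {0}. \<iota> c) =
          (-1) ^ d * ((\<iota> (Llcm d) * (\<Prod>c\<in>Alt d - {0}. \<iota> c)) / \<iota> (Dprod d))"
      by (simp add: k_def)
    thus ?thesis by (simp add: hom_Llcm)
  qed
  have poly_F: "poly F z = k * (\<Sum>b\<in>Aplus d. poly_at \<iota> b t * (\<Prod>a\<in>Aplus d - {b}. z - \<iota> a))" for z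
    by (simp add: F_def poly_sum poly_prod)
  have poly_H: "poly H z = t ^ d + partial_sum t d (z - \<iota> (monom 1 d))" for z
    by (simp add: H_def poly_sum poly_pcompose partial_sum_def)
  have card: "card (\<iota> ` Aplus d) = CARD('a) ^ d"
    using card_image[OF inj_on_subset[OF inj_hom subset_UNIV], of "Aplus d"] by (simp add: card_Aplus)
  have "F = H"
  proof (rule poly_eqI_degree)
    fix z assume "z \<in> \<iota> ` Aplus d"
    then obtain b where b: "b \<in> Aplus d" "z = \<iota> b" by auto
    \<comment> \<open>At z = b every summand with b' different from b contains the factor b -
      b.\<close>
    have "(\<Sum>b'\<in>Aplus d. poly_at \<iota> b' t * (\<Prod>a\<in>Aplus d - {b'}. z - \<iota> a)) =
          (\<Sum>b'\<in>{b}. poly_at \<iota> b' t * (\<Prod>a\<in>Aplus d - {b'}. z - \<iota> a))"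
      using b by (intro sum.mono_neutral_right) (auto simp: finite_Aplus)
    moreover have "(\<Prod>a\<in>Aplus d - {b}. z - \<iota> a) = (\<Prod>c\<in>Alt d - {0}. \<iota> c)"
    proof -
      have "bij_betw (\<lambda>c. b - c) (Alt d - {0}) (Aplus d - {b})"
        by (rule bij_betwI') (auto simp: Aplus_eq_image_Alt[OF b(1)])
      from prod.reindex_bij_betw[OF this, of "\<lambda>a. z - \<iota> a"]
      show ?thesis by (simp add: b hom_diff)
    qed
    ultimately have "poly F z = poly_at \<iota> b t * (k * (\<Prod>c\<in>Alt d - {0}. \<iota> c))"
      by (simp add: poly_F)
    \<comment> \<open>Splitting off \<theta>^d leaves an element of A(d), to which the assumption on
      the partial sum applies.\<close>
    also have "\<dots> = poly_at \<iota> (monom 1 d + (b - monom 1 d)) t" by (simp add: k)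
    also have "\<dots> = t ^ d + poly_at \<iota> (b - monom 1 d) t"
      unfolding poly_at_add poly_at_monom by (simp add: one_pCons [symmetric])
    also have "b - monom 1 d \<in> Alt d"
      using b(1) by (auto simp: Aplus_iff_coeff Alt_iff_coeff)
    hence "poly_at \<iota> (b - monom 1 d) t = partial_sum t d (z - \<iota> (monom 1 d))"
      using IH[of "b - monom 1 d"] by (simp add: b hom_diff)
    finally show "poly F z = poly H z" by (simp add: poly_H)
  next
    have "degree F \<le> CARD('a) ^ d - 1"
      unfolding F_def
    proof (intro order.trans[OF degree_smult_le] degree_sum_le)
      fix b :: "'a poly" assume "b \<in> Aplus d"
      hence "card (Aplus d - {b}) = CARD('a) ^ d - 1"
        by (simp add: card_Aplus card_Diff_singleton)
      thus "degree (\<Prod>a\<in>Aplus d - {b}. [:- \<iota> a, 1:]) \<le> CARD('a) ^ d - 1"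
        by (subst degree_prod_sum_eq) auto
    qed (simp add: finite_Aplus)
    thus "degree F < card (\<iota> ` Aplus d)" unfolding card
      by (metis Suc_pred' less_Suc_eq_le zero_less_card_finite zero_less_power)
  next
    \<comment> \<open>Only the e_j with j < d occur, and they have degree q^j < q^d because q \<ge>
      2.\<close>
    have "degree H < CARD('a) ^ d" unfolding H_def
    proof (rule degree_add_less)
      show "degree (\<Sum>j<d. smult (b_at \<iota> t j / \<iota> (Dprod j))
                        (pcompose (e_poly j) [:- \<iota> (monom 1 d), 1:])) < CARD('a) ^ d"
      proof (rule degree_sum_less)
        fix j assume "j \<in> {..<d}"
        hence "CARD('a) ^ j < CARD('a) ^ d"
          using CARD_field_ge_2[where 'a='a] by (intro power_strict_increasing) auto
        thus "degree (smult (b_at \<iota> t j / \<iota> (Dprod j))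
                        (pcompose (e_poly j) [:- \<iota> (monom 1 d), 1:])) < CARD('a) ^ d"
          by (intro le_less_trans[OF degree_smult_le]) (simp add: degree_pcompose degree_e_poly)
      qed simp
    qed simp
    thus "degree H < card (\<iota> ` Aplus d)" unfolding card .
  qed
  \<comment> \<open>At 0 the Lagrange side is the definition of b_d(t), and oddness of the partial
    sum turns the value at -\<theta>^d into the negative of that at \<theta>^d.\<close>
  hence "poly F 0 = poly H 0" by simp
  moreover have "poly F 0 = b_at \<iota> t d"
    by (simp add: poly_F b_at_def k_def Mchi_at_0)
  ultimately show ?thesis by (simp add: poly_H partial_sum_uminus)
qed

text \<open>Write a = c \<theta>^d + a' with a' in A(d). The new term vanishes at a', because e_d
  does, and by \<open>b_at_eq\<close> it corrects the value at \<theta>^d to t^d; linearity combines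
  the two.\<close>

theorem partial_sum_Alt: "a \<in> Alt d \<Longrightarrow> partial_sum t d (\<iota> a) = poly_at \<iota> a t"
proof (induction d arbitrary: a)
  case 0
  thus ?case by (simp add: Alt_0 partial_sum_def poly_at_def)
next
  case (Suc d)
  define c a' where "c = coeff a d" and "a' = a - monom c d"
  have a': "a' \<in> Alt d"
    using Suc.prems by (auto simp: a'_def c_def Alt_iff_coeff)
  have a: "a = [:c:] * monom 1 d + a'" by (simp add: a'_def smult_monom)
  have step: "partial_sum t (Suc d) z = partial_sum t d z + b_at \<iota> t d * (e_at \<iota> d z / \<iota> (Dprod d))" for z
    by (simp add: partial_sum_def)
  have 1: "partial_sum t (Suc d) (\<iota> (monom 1 d)) = t ^ d"
    using b_at_eq[OF Suc.IH] by (simp add: step e_at_Aplus[OF monom_in_Aplus])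
  have 2: "partial_sum t (Suc d) (\<iota> a') = poly_at \<iota> a' t"
    using a' by (simp add: step Suc.IH e_at_Alt)
  have "partial_sum t (Suc d) (\<iota> a) = \<iota> [:c:] * t ^ d + poly_at \<iota> a' t"
    by (subst a) (simp only: hom_add hom_mult partial_sum_add partial_sum_scale 1 2)
  also have "\<dots> = poly_at \<iota> (monom c d + a') t"
    by (simp add: poly_at_add poly_at_monom)
  finally show ?case by (simp add: a'_def)
qed

end

section \<open>Ultrametric estimates and convergence\<close>

locale nonarchimedean_embedding = poly_embedding \<iota>
  for \<iota> :: "'a::{finite,field_gcd} poly \<Rightarrow> 'c::field" +
  fixes av :: "'c \<Rightarrow> real"
  assumes av_nonneg: "av x \<ge> 0"
    and av_eq_0_iff [simp]: "av x = 0 \<longleftrightarrow> x = 0"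
    and av_mult: "av (x * y) = av x * av y"
    and av_add: "av (x + y) \<le> max (av x) (av y)"
    and av_hom: "p \<noteq> 0 \<Longrightarrow> av (\<iota> p) = real CARD('a) ^ degree p"
    and av_complete: "(\<And>e. e > 0 \<Longrightarrow> \<exists>N. \<forall>m\<ge>N. \<forall>n\<ge>N. av (X m - X n) < e) \<Longrightarrow>
          \<exists>L. (\<lambda>n. av (L - X n)) \<longlonglongrightarrow> 0"
begin

lemma av_0 [simp]: "av 0 = 0"
  by simp

lemma av_1 [simp]: "av 1 = 1"
  using av_mult[of 1 1] by simp

lemma av_uminus [simp]: "av (- x) = av x"
proof -
  have "av (-1) * av (-1) = 1" using av_mult[of "-1" "-1"] by simp
  hence "av (-1) = 1" using av_nonneg[of "-1"] by (auto simp: square_eq_1_iff)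
  thus ?thesis using av_mult[of "-1" x] by simp
qed

lemma av_prod: "av (\<Prod>x\<in>S. f x) = (\<Prod>x\<in>S. av (f x))"
  by (induction S rule: infinite_finite_induct) (auto simp: av_mult)

lemma av_power: "av (x ^ n) = av x ^ n"
  by (induction n) (auto simp: av_mult)

lemma av_divide: "av (x / y) = av x / av y"
  using av_mult[of "x / y" y] by (cases "y = 0") (auto simp: field_simps)

lemma av_diff: "av (x - y) \<le> max (av x) (av y)"
  using av_add[of x "-y"] by simp

lemma av_sum_le: "(\<And>x. x \<in> S \<Longrightarrow> av (f x) \<le> B) \<Longrightarrow> B \<ge> 0 \<Longrightarrow> av (\<Sum>x\<in>S. f x) \<le> B"
proof (induction S rule: infinite_finite_induct)
  case (insert x S)
  thus ?case using av_add[of "f x" "sum f S"] by fastforce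
qed auto

text \<open>By the ultrametric inequality a block of terms is no larger than its largest term, so
  null terms make the partial sums Cauchy.\<close>

lemma series_sums_if_tendsto_0:
  assumes "(\<lambda>j. av (f j)) \<longlonglongrightarrow> 0"
  shows "\<exists>S. series_sums av f S"
  unfolding series_sums_def
proof (rule av_complete)
  fix e :: real assume e: "e > 0"
  \<comment> \<open>Half of e, because \<open>av_sum_le\<close> yields only a weak inequality and
    the Cauchy condition is strict.\<close>
  hence "eventually (\<lambda>j. av (f j) < e / 2) sequentially"
    using assms by (intro order_tendstoD) auto
  then obtain N where N: "av (f j) < e / 2" if "j \<ge> N" for j
    by (auto simp: eventually_sequentially)
  have le: "av (sum f {..<m} - sum f {..<n}) \<le> e / 2" if "n \<ge> N" "n \<le> m" for m n
  proof -
    have "sum f {..<m} - sum f {..<n} = sum f {n..<m}"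
      using that by (simp add: sum_diff_nat_ivl lessThan_atLeast0)
    moreover have "av (f j) \<le> e / 2" if "j \<in> {n..<m}" for j
      using N[of j] that \<open>n \<ge> N\<close> by auto
    hence "av (sum f {n..<m}) \<le> e / 2"
      using e by (intro av_sum_le) auto
    ultimately show ?thesis by simp
  qed
  have "av (sum f {..<m} - sum f {..<n}) < e" if "m \<ge> N" "n \<ge> N" for m n
  proof (cases "n \<le> m")
    case True
    thus ?thesis using le[of n m] that e by simp
  next
    case False
    hence "av (- (sum f {..<n} - sum f {..<m})) \<le> e / 2"
      unfolding av_uminus using le[of m n] that by simp
    thus ?thesis using e by simp
  qed
  thus "\<exists>N. \<forall>m\<ge>N. \<forall>n\<ge>N. av (sum f {..<m} - sum f {..<n}) < e" by blast
qed

text \<open>Coefficients from F_q have absolute value at most 1, so only powers of t count; the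
  maximum with 1 covers |t| < 1.\<close>

lemma av_poly_at_le: "av (poly_at \<iota> b t) \<le> max 1 (av t) ^ degree b"
proof -
  have const: "av (\<iota> [:c:]) \<le> 1" for c
    using av_hom[of "[:c:]"] by (cases "c = 0") auto
  have "poly_at \<iota> b t = (\<Sum>i\<le>degree b. \<iota> [:coeff b i:] * t ^ i)"
  proof -
    have "degree (map_poly (\<lambda>c. \<iota> [:c:]) b) = degree b"
      using hom_eq_0 by (intro degree_map_poly) fastforce
    thus ?thesis by (simp add: poly_at_def poly_altdef coeff_map_poly)
  qed
  also have "av \<dots> \<le> max 1 (av t) ^ degree b"
  proof (rule av_sum_le)
    fix i assume i: "i \<in> {..degree b}"
    have "av (\<iota> [:coeff b i:] * t ^ i) \<le> 1 * max 1 (av t) ^ i"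
      unfolding av_mult av_power by (intro mult_mono const power_mono) (auto simp: av_nonneg)
    also have "\<dots> \<le> max 1 (av t) ^ degree b" using i by (auto intro!: power_increasing)
    finally show "av (\<iota> [:coeff b i:] * t ^ i) \<le> max 1 (av t) ^ degree b" .
  qed simp
  finally show ?thesis .
qed

text \<open>Each summand of M_j(0) is, up to sign, b(t) D_j / b with |b| = q^j, and the ultrametric
  inequality bounds the sum by the common bound of its summands.\<close>

lemma av_Mchi_le:
  "av (poly (map_poly \<iota> (poly (Mchi j) 0)) t) \<le>
     (max 1 (av t) / real CARD('a)) ^ j * av (\<iota> (Dprod j))"
  unfolding Mchi_at_0
proof (rule av_sum_le)
  fix b :: "'a poly" assume b: "b \<in> Aplus j"
  have av_b: "av (\<iota> b) = real CARD('a) ^ j"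
    using b Aplus_nonzero[OF b] av_hom[of b] by (simp add: Aplus_def)
  have "\<iota> (Dprod j) = \<iota> b * (\<Prod>a\<in>Aplus j - {b}. \<iota> a)"
    unfolding Dprod_def hom_prod by (rule prod.remove) (use b finite_Aplus in auto)
  hence "av (\<iota> (Dprod j)) = real CARD('a) ^ j * av (\<Prod>a\<in>Aplus j - {b}. \<iota> a)"
    by (simp add: av_mult av_b)
  hence D: "av (\<iota> (Dprod j)) / real CARD('a) ^ j = (\<Prod>a\<in>Aplus j - {b}. av (\<iota> a))"
    by (simp add: av_prod)
  have "av (poly_at \<iota> b t * (\<Prod>a\<in>Aplus j - {b}. - \<iota> a)) =
        av (poly_at \<iota> b t) * (av (\<iota> (Dprod j)) / real CARD('a) ^ j)"
    unfolding D by (simp add: av_mult av_prod)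
  also have "\<dots> \<le> max 1 (av t) ^ j * (av (\<iota> (Dprod j)) / real CARD('a) ^ j)"
    using av_poly_at_le[of b t] b
    by (intro mult_right_mono) (auto simp: Aplus_def av_nonneg)
  finally show "av (poly_at \<iota> b t * (\<Prod>a\<in>Aplus j - {b}. - \<iota> a)) \<le>
      (max 1 (av t) / real CARD('a)) ^ j * av (\<iota> (Dprod j))"
    by (simp add: power_divide)
qed (simp add: av_nonneg)

text \<open>For c nonzero, |z - c| \<le> max(|z|, |c|) = |c| g(c), where g(c) = 1 once |c| \<ge>
  |z|. Only finitely many c exceed 1 in g, which yields one constant for all j.\<close>

lemma av_e_at_bounded:
  "\<exists>C\<ge>0. \<forall>j. av (e_at \<iota> j z) \<le> C * av (\<Prod>c\<in>Alt j - {0}. \<iota> c)"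
proof -
  have "1 < real CARD('a)" using CARD_field_ge_2[where 'a='a] by simp
  then obtain m where m: "av z < real CARD('a) ^ m"
    using real_arch_pow by blast
  define g where "g c = max 1 (av z / av (\<iota> c))" for c
  have g1: "g c = 1" if "c \<notin> Alt m" for c
  proof -
    have "c \<noteq> 0" "degree c \<ge> m" using that by (auto simp: Alt_def)
    hence "real CARD('a) ^ m \<le> av (\<iota> c)"
      using \<open>1 < real CARD('a)\<close> by (simp add: av_hom power_increasing)
    hence "av z / av (\<iota> c) \<le> 1" using m av_nonneg[of z] by (simp add: divide_le_eq_1)
    thus ?thesis by (simp add: g_def)
  qed
  have bound: "av (e_at \<iota> j z) \<le> (av z * (\<Prod>c\<in>Alt m - {0}. g c)) * av (\<Prod>c\<in>Alt j - {0}. \<iota> c)" for j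
  proof -
    have "e_at \<iota> j z = z * (\<Prod>c\<in>Alt j - {0}. z - \<iota> c)"
      unfolding e_at_def by (subst prod.remove[of _ 0]) (auto simp: finite_Alt, simp add: Alt_def)
    hence "av (e_at \<iota> j z) = av z * (\<Prod>c\<in>Alt j - {0}. av (z - \<iota> c))"
      by (simp add: av_mult av_prod)
    also have "\<dots> \<le> av z * (\<Prod>c\<in>Alt j - {0}. g c * av (\<iota> c))"
    proof (intro mult_left_mono prod_mono conjI)
      fix c :: "'a poly" assume c: "c \<in> Alt j - {0}"
      hence "av (\<iota> c) > 0" using hom_eq_0 av_nonneg[of "\<iota> c"] by (auto simp: less_le)
      hence "g c * av (\<iota> c) = max (av (\<iota> c)) (av z)"
        by (auto simp: g_def max_mult_distrib_right)
      thus "av (z - \<iota> c) \<le> g c * av (\<iota> c)" using av_diff[of z "\<iota> c"] by simp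
    qed (auto simp: av_nonneg)
    also have "\<dots> = (av z * (\<Prod>c\<in>Alt j - {0}. g c)) * av (\<Prod>c\<in>Alt j - {0}. \<iota> c)"
      by (simp add: prod.distrib av_prod)
    also have "(\<Prod>c\<in>Alt j - {0}. g c) = (\<Prod>c\<in>Alt j \<inter> Alt m - {0}. g c)"
      by (rule prod.mono_neutral_right) (use g1 in \<open>auto simp: finite_Alt\<close>)
    \<comment> \<open>Since g \<ge> 1 everywhere, enlarging the index set to A(m) without 0 can only
      increase the product and removes j from the constant.\<close>
    also have "av z * \<dots> * av (\<Prod>c\<in>Alt j - {0}. \<iota> c) \<le>
        av z * (\<Prod>c\<in>Alt m - {0}. g c) * av (\<Prod>c\<in>Alt j - {0}. \<iota> c)"
    proof (intro mult_right_mono mult_left_mono prod_mono2)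
      show "0 \<le> g c" for c by (simp add: g_def)
    qed (auto simp: finite_Alt av_nonneg g_def)
    finally show ?thesis .
  qed
  have "av z * (\<Prod>c\<in>Alt m - {0}. g c) \<ge> 0"
    by (intro mult_nonneg_nonneg prod_nonneg) (auto simp: av_nonneg g_def)
  thus ?thesis using bound by blast
qed

theorem series_converges:
  assumes "av t < real CARD('a)"
  shows "\<exists>S. series_sums av (\<lambda>j. b_at \<iota> t j * (e_at \<iota> j z / \<iota> (Dprod j))) S"
proof (rule series_sums_if_tendsto_0)
  \<comment> \<open>The ratio of the geometric majorant; r < 1 combines |t| < q with q > 1.\<close>
  define r where "r = max 1 (av t) / real CARD('a)"
  have r: "0 \<le> r" "r < 1"
    using assms CARD_field_ge_2[where 'a='a] by (auto simp: r_def)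
  obtain C where C: "C \<ge> 0" "av (e_at \<iota> j z) \<le> C * av (\<Prod>c\<in>Alt j - {0}. \<iota> c)" for j
    using av_e_at_bounded by blast
  have le: "av (b_at \<iota> t j * (e_at \<iota> j z / \<iota> (Dprod j))) \<le> r ^ j * C" for j
  proof -
    let ?M = "poly (map_poly \<iota> (poly (Mchi j) 0)) t"
    let ?D = "av (\<iota> (Dprod j))" and ?Q = "av (\<Prod>c\<in>Alt j - {0}. \<iota> c)"
    have D: "?D > 0" using av_nonneg[of "\<iota> (Dprod j)"] by (simp add: less_le)
    have Q: "?Q > 0"
      using av_nonneg[of "\<Prod>c\<in>Alt j - {0}. \<iota> c"] hom_prod_Alt_nonzero[of j] by (simp add: less_le del: prod_zero_iff)
    \<comment> \<open>With |L_j| = |D_j| / |Q| the j-th term factors into |M| / |D_j|, which decays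
      geometrically, and |e_j(z)| / |Q|, which stays bounded.\<close>
    have "av (\<iota> (Llcm j)) * ?Q = ?D"
      using arg_cong[OF hom_Llcm, of av j] by (simp add: av_mult av_power)
    hence L: "av (\<iota> (Llcm j)) = ?D / ?Q"
      by (rule nonzero_eq_divide_eq[THEN iffD2, rotated]) (use Q in linarith)
    have "av (b_at \<iota> t j * (e_at \<iota> j z / \<iota> (Dprod j))) = (av ?M / ?D) * (av (e_at \<iota> j z) / ?Q)"
      using D Q by (simp add: b_at_def av_mult av_divide av_power L)
    also have "\<dots> \<le> r ^ j * C"
    proof (rule mult_mono)
      show "av ?M / ?D \<le> r ^ j"
        using av_Mchi_le[of j t] D by (simp add: r_def divide_le_eq)
      show "av (e_at \<iota> j z) / ?Q \<le> C" using C(2)[of j] Q by (simp add: divide_le_eq)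
    qed (use r in \<open>auto simp: av_nonneg\<close>)
    finally show ?thesis .
  qed
  have "(\<lambda>j. r ^ j * C) \<longlonglongrightarrow> 0"
    using r by (intro tendsto_mult_left_zero LIMSEQ_realpow_zero) auto
  thus "(\<lambda>j. av (b_at \<iota> t j * (e_at \<iota> j z / \<iota> (Dprod j)))) \<longlonglongrightarrow> 0"
    by (rule tendsto_sandwich[OF always_eventually always_eventually tendsto_const, rotated 2])
       (use av_nonneg le in blast)+
qed

text \<open>Once n exceeds the degree of a, the n-th partial sum at a is exactly a(t), so the error
  is eventually constantly 0.\<close>

theorem series_interpolates:
  "series_sums av (\<lambda>j. b_at \<iota> t j * (e_at \<iota> j (\<iota> a) / \<iota> (Dprod j))) (poly_at \<iota> a t)"
proof -
  have "a \<in> Alt n" if "n > degree a" for n using that by (simp add: Alt_def)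
  hence "eventually (\<lambda>n. av (poly_at \<iota> a t - partial_sum t n (\<iota> a)) = 0) sequentially"
    by (intro eventually_mono[OF eventually_gt_at_top[of "degree a"]]) (simp add: partial_sum_Alt)
  thus ?thesis
    unfolding series_sums_def partial_sum_def [symmetric] by (rule tendsto_eventually)
qed

end

section \<open>Transfer to the model of C_infinity\<close>

theorem theorem4p2p6:
  fixes \<iota> :: "('a::{finite,field_gcd}) poly \<Rightarrow> 'c::field" and av :: "'c \<Rightarrow> real" and t :: 'c
  assumes "Cinf_model \<iota> av"
    and "av t < real CARD('a)"
  shows "(\<forall>z. \<exists>S. series_sums av (\<lambda>j. b_at \<iota> t j * (e_at \<iota> j z / \<iota> (Dprod j))) S)
       \<and> (\<forall>a. series_sums av (\<lambda>j. b_at \<iota> t j * (e_at \<iota> j (\<iota> a) / \<iota> (Dprod j))) (poly_at \<iota> a t))"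
proof -
  note model = assms(1)[unfolded Cinf_model_def]
  interpret nonarchimedean_embedding \<iota> av
  proof
    \<comment> \<open>Injectivity comes from the normalization of \<open>av\<close>: a nonzero
      polynomial has absolute value a power of q, which is not 0.\<close>
    show "x = 0" if "\<iota> x = 0" for x
    proof (rule ccontr)
      assume "x \<noteq> 0"
      hence "av (\<iota> x) = real CARD('a) ^ degree x" using model by blast
      moreover have "av (\<iota> x) = 0" using model that by presburger
      ultimately show False by simp
    qed
  qed (use model in blast)+
  show ?thesis using series_converges[OF assms(2)] series_interpolates by blast
qed

end
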